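(* Let $$k(s)=\frac{e^{-s}-1}{s},\qquad H(s,t)=\frac{e^{-s-t}\big((e^s-1)(3e^t+1)\,t-(e^s+3)\,s\,(e^t-1)\big)}{2st(s+t)},$$ and set $\tilde k(s)=e^sk(s)$, $\tilde H(s,t)=e^{s+t}H(s,t)$. Then $$\tilde H(s,t)=2\,\frac{\tilde k(s+t)-\tilde k(s)}{t}+\frac32\,\tilde k(s)\,\tilde k(t).$$
   Context: $s,t$ are real variables; the functions are defined by the displayed formulas where the denominators are nonzero and by their smooth extensions across the removable singularities elsewhere. (These $k$ and $H$ are the one- and two-variable functions describing the scalar curvature of the conformally perturbed noncommutative four torus.) *)

theory Defs
  imports "HOL-Analysis.Analysis"
begin

text \<open>\<open>C_times n f\<close>: the function \<open>f\<close> is of class $C^n$ on the whole space. Since the domain is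
  finite-dimensional, asking that every directional derivative be of class $C^{n-1}$ is the same
  as asking it of the total derivative.\<close>

primrec C_times :: "nat \<Rightarrow> ('a::euclidean_space \<Rightarrow> real) \<Rightarrow> bool" where
  "C_times 0 f \<longleftrightarrow> continuous_on UNIV f"
| "C_times (Suc n) f \<longleftrightarrow>
     (\<exists>f'. (\<forall>x. (f has_derivative f' x) (at x)) \<and> (\<forall>v. C_times n (\<lambda>x. f' x v)))"

definition smooth :: "('a::euclidean_space \<Rightarrow> real) \<Rightarrow> bool" where
  "smooth f \<longleftrightarrow> (\<forall>n. C_times n f)"

text \<open>The smooth function on the whole space that agrees with \<open>f\<close> on \<open>S\<close>. It is unique when \<open>S\<close>
  is dense, as in all uses below; nothing is known about the value if no such function exists.\<close>

definition smooth_ext :: "'a::euclidean_space set \<Rightarrow> ('a \<Rightarrow> real) \<Rightarrow> 'a \<Rightarrow> real" where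
  "smooth_ext S f = (THE F. smooth F \<and> (\<forall>x\<in>S. F x = f x))"

definition k :: "real \<Rightarrow> real" where
  "k = smooth_ext {s. s \<noteq> 0} (\<lambda>s. (exp (- s) - 1) / s)"

definition H :: "real \<Rightarrow> real \<Rightarrow> real" where
  "H s t = smooth_ext {(s, t). s \<noteq> 0 \<and> t \<noteq> 0 \<and> s + t \<noteq> 0}
     (\<lambda>(s, t). exp (- s - t) *
        ((exp s - 1) * (3 * exp t + 1) * t - (exp s + 3) * s * (exp t - 1)) /
        (2 * s * t * (s + t))) (s, t)"

definition k_tilde :: "real \<Rightarrow> real" where
  "k_tilde s = exp s * k s"

definition H_tilde :: "real \<Rightarrow> real \<Rightarrow> real" where
  "H_tilde s t = exp (s + t) * H s t"

text \<open>The difference quotient $(f(s+t)-f(s))/t$ as a function of \<open>(s, t)\<close>, again extended smoothly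
  across the removable singularity \<open>t = 0\<close> (where, for smooth \<open>f\<close>, its value is $f'(s)$).\<close>

definition diff_quot :: "(real \<Rightarrow> real) \<Rightarrow> real \<Rightarrow> real \<Rightarrow> real" where
  "diff_quot f s t = smooth_ext {(s, t). t \<noteq> 0} (\<lambda>(s, t). (f (s + t) - f s) / t) (s, t)"

end

theory Submission imports Defs begin

text \<open>Away from the singular lines the identity is elementary algebra: over the common
  denominator \<open>2 * s * t * (s + t)\<close> both sides have the same numerator. On the singular lines each
  of \<open>k\<close>, \<open>H\<close> and the difference quotient is only given as \<^emph>\<open>the\<close> smooth extension of a quotient,
  so such extensions have to be exhibited and shown to be unique.

  Uniqueness holds because the complement of each domain is negligible, so the domain is dense, and
  continuous functions that agree on a dense set are equal (\<open>smooth_ext_eqI\<close>). For existence, the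
  extensions are written as averages of exponentials: the extension of \<open>(exp s - 1) / s\<close> is the
  integral of \<open>exp (u * s)\<close> over \<open>u\<close> in \<open>[0, 1]\<close> (this is \<open>- k_tilde s\<close>), and by the fundamental theorem of calculus and
  Fubini the difference quotient of this function is the integral of \<open>u * exp (u * (s + r * t))\<close>
  over \<open>(u, r)\<close> in the unit square. All these are integrals of \<open>p y * exp (l y \<bullet> x)\<close> over \<open>y\<close> in a
  box. A directional derivative in \<open>x\<close> is again an integral of this kind, with \<open>p y\<close> replaced by
  \<open>p y * (l y \<bullet> v)\<close>, so all of them are smooth (\<open>smooth_integral_exp\<close>). The right-hand side of the
  claim, multiplied by \<open>exp (- s - t)\<close>, is thus a smooth function that agrees with the quotient
  defining \<open>H\<close> off the singular lines; hence it is \<open>H\<close>.\<close>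

section \<open>Smooth functions\<close>

lemma C_times_SucD: "C_times (Suc n) f \<Longrightarrow> C_times n f"
proof (induction n arbitrary: f)
  case 0
  then obtain f' where "\<forall>x. (f has_derivative f' x) (at x)" by auto
  then have "continuous_on UNIV f"
    by (meson continuous_at_imp_continuous_on has_derivative_continuous)
  then show ?case by simp
next
  case (Suc n)
  then obtain f' where "\<forall>x. (f has_derivative f' x) (at x)"
    and "\<forall>v. C_times (Suc n) (\<lambda>x. f' x v)"
    by (metis C_times.simps(2))
  then show ?case using Suc.IH by (metis C_times.simps(2))
qed

lemma C_times_add: "C_times n f \<Longrightarrow> C_times n g \<Longrightarrow> C_times n (\<lambda>x. f x + g x)"
proof (induction n arbitrary: f g)
  case 0
  then show ?case by (simp add: continuous_on_add)
next
  case (Suc n)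
  from Suc.prems(1) obtain f' where f: "\<And>x. (f has_derivative f' x) (at x)"
    "\<And>v. C_times n (\<lambda>x. f' x v)" by auto
  from Suc.prems(2) obtain g' where g: "\<And>x. (g has_derivative g' x) (at x)"
    "\<And>v. C_times n (\<lambda>x. g' x v)" by auto
  have "((\<lambda>x. f x + g x) has_derivative (\<lambda>v. f' x v + g' x v)) (at x)" for x
    by (rule has_derivative_add[OF f(1) g(1)])
  moreover have "C_times n (\<lambda>x. f' x v + g' x v)" for v
    by (rule Suc.IH[OF f(2) g(2)])
  ultimately show ?case
    unfolding C_times.simps by (intro exI[of _ "\<lambda>x v. f' x v + g' x v"]) auto
qed

lemma C_times_mult: "C_times n f \<Longrightarrow> C_times n g \<Longrightarrow> C_times n (\<lambda>x. f x * g x)"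
proof (induction n arbitrary: f g)
  case 0
  then show ?case by (simp add: continuous_on_mult)
next
  case (Suc n)
  from Suc.prems(1) obtain f' where f: "\<And>x. (f has_derivative f' x) (at x)"
    "\<And>v. C_times n (\<lambda>x. f' x v)" by auto
  from Suc.prems(2) obtain g' where g: "\<And>x. (g has_derivative g' x) (at x)"
    "\<And>v. C_times n (\<lambda>x. g' x v)" by auto
  have "((\<lambda>x. f x * g x) has_derivative (\<lambda>v. f x * g' x v + f' x v * g x)) (at x)" for x
    by (rule has_derivative_mult[OF f(1) g(1)])
  moreover have "C_times n (\<lambda>x. f x * g' x v + f' x v * g x)" for v
    by (rule C_times_add; rule Suc.IH)
      (rule f(2) g(2) C_times_SucD[OF Suc.prems(1)]
        C_times_SucD[OF Suc.prems(2)])+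
  ultimately show ?case
    unfolding C_times.simps by (intro exI[of _ "\<lambda>x v. f x * g' x v + f' x v * g x"]) auto
qed

lemma smooth_add: "smooth f \<Longrightarrow> smooth g \<Longrightarrow> smooth (\<lambda>x. f x + g x)"
  by (simp add: smooth_def C_times_add)

lemma smooth_mult: "smooth f \<Longrightarrow> smooth g \<Longrightarrow> smooth (\<lambda>x. f x * g x)"
  by (simp add: smooth_def C_times_mult)

lemma smooth_imp_continuous_on: "smooth f \<Longrightarrow> continuous_on UNIV f"
  unfolding smooth_def by (metis C_times.simps(1))

text \<open>The total derivative is computed under the integral sign; \<open>blinfun_inner_right a\<close> is the
  bounded linear form \<open>\<lambda>v. a \<bullet> v\<close>.\<close>

lemma has_derivative_integral_exp:
  fixes l :: "'b::euclidean_space \<Rightarrow> 'a::euclidean_space" and p :: "'b \<Rightarrow> real"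
  assumes "continuous_on (cbox a b) p" "continuous_on (cbox a b) l"
  shows "((\<lambda>x. integral (cbox a b) (\<lambda>y. p y * exp (l y \<bullet> x))) has_derivative
     (\<lambda>v. integral (cbox a b) (\<lambda>y. p y * (l y \<bullet> v) * exp (l y \<bullet> x)))) (at x)"
proof -
  define D :: "'a \<Rightarrow> 'b \<Rightarrow> 'a \<Rightarrow>\<^sub>L real"
    where "D x y = (p y * exp (l y \<bullet> x)) *\<^sub>R blinfun_inner_right (l y)" for x y
  have snd_cont: "continuous_on (UNIV \<times> cbox a b) (\<lambda>z. h (snd z))"
    if "continuous_on (cbox a b) h" for h :: "'b \<Rightarrow> 'c::topological_space"
    by (rule continuous_on_compose2[OF that]) (auto intro: continuous_intros)
  have D_cont: "continuous_on (UNIV \<times> cbox a b) (\<lambda>(x, y). D x y)"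
    unfolding D_def case_prod_beta
    by (intro continuous_intros snd_cont assms
        bounded_linear.continuous_on[OF bounded_linear_blinfun_inner_right])
  have D_deriv: "((\<lambda>x. p y * exp (l y \<bullet> x)) has_derivative blinfun_apply (D x y))
      (at x within UNIV)" for x y
    unfolding D_def
    by (auto intro!: derivative_eq_intros simp: blinfun.bilinear_simps fun_eq_iff)
  have int: "(\<lambda>y. p y * exp (l y \<bullet> x)) integrable_on cbox a b" for x
    by (intro integrable_continuous continuous_intros assms)
  have "((\<lambda>x. integral (cbox a b) (\<lambda>y. p y * exp (l y \<bullet> x))) has_derivative
      integral (cbox a b) (D x)) (at x within UNIV)"
    by (rule leibniz_rule[OF D_deriv int D_cont]) auto
  moreover have "D x integrable_on cbox a b"
    unfolding D_def
    by (intro integrable_continuous continuous_intros assms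
        bounded_linear.continuous_on[OF bounded_linear_blinfun_inner_right])
  then have "blinfun_apply (integral (cbox a b) (D x)) =
      (\<lambda>v. integral (cbox a b) (\<lambda>y. p y * (l y \<bullet> v) * exp (l y \<bullet> x)))"
    by (auto simp: blinfun_apply_integral fun_eq_iff D_def blinfun.bilinear_simps mult_ac
        intro!: integral_cong)
  ultimately show ?thesis by simp
qed

lemma smooth_integral_exp:
  fixes l :: "'b::euclidean_space \<Rightarrow> 'a::euclidean_space" and p :: "'b \<Rightarrow> real"
  assumes "continuous_on (cbox a b) p" and l: "continuous_on (cbox a b) l"
  shows "smooth (\<lambda>x. integral (cbox a b) (\<lambda>y. p y * exp (l y \<bullet> x)))"
  unfolding smooth_def
proof
  fix n
  show "C_times n (\<lambda>x. integral (cbox a b) (\<lambda>y. p y * exp (l y \<bullet> x)))"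
    using assms(1)
  proof (induction n arbitrary: p)
    case 0
    show ?case
      using has_derivative_continuous[OF has_derivative_integral_exp[OF 0 l]]
      by (simp add: continuous_at_imp_continuous_on)
  next
    case (Suc n)
    have "C_times n (\<lambda>x. integral (cbox a b) (\<lambda>y. p y * (l y \<bullet> v) * exp (l y \<bullet> x)))" for v
      by (intro Suc.IH continuous_intros Suc.prems l)
    then show ?case
      using has_derivative_integral_exp[OF Suc.prems l] unfolding C_times.simps
      by (intro exI[of _ "\<lambda>x v. integral (cbox a b) (\<lambda>y. p y * (l y \<bullet> v) * exp (l y \<bullet> x))"]) auto
  qed
qed

section \<open>Uniqueness of smooth extensions\<close>

lemma smooth_ext_eqI:
  assumes "negligible (- S)" and F: "smooth F" "\<And>x. x \<in> S \<Longrightarrow> F x = f x"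
  shows "smooth_ext S f = F"
  unfolding smooth_ext_def
proof (rule the_equality)
  have "interior (- S) = {}"
    using assms(1) open_not_negligible negligible_subset interior_subset open_interior by metis
  then have dense: "closure S = UNIV"
    by (metis interior_complement double_complement Compl_empty_eq)
  show "G = F" if "smooth G \<and> (\<forall>x\<in>S. G x = f x)" for G
  proof
    fix x
    have "continuous_on (closure S) (\<lambda>x. G x - F x)"
      using that F(1) unfolding dense
      by (intro continuous_on_diff smooth_imp_continuous_on) auto
    then have "G x - F x = 0"
      by (rule continuous_constant_on_closure) (use that F(2) dense in auto)
    then show "G x = F x" by simp
  qed
qed (use F in auto)

lemma negligible_fst_eq_0: "negligible {(s::real, t::real). s = 0}"
  using negligible_hyperplane[of "(1, 0) :: real \<times> real" 0]
  by (simp add: case_prod_unfold inner_prod_def zero_prod_def)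

lemma negligible_snd_eq_0: "negligible {(s::real, t::real). t = 0}"
  using negligible_hyperplane[of "(0, 1) :: real \<times> real" 0]
  by (simp add: case_prod_unfold inner_prod_def zero_prod_def)

lemma negligible_add_eq_0: "negligible {(s::real, t::real). s + t = 0}"
  using negligible_hyperplane[of "(1, 1) :: real \<times> real" 0]
  by (simp add: case_prod_unfold inner_prod_def zero_prod_def)

section \<open>The function \<open>(exp s - 1) / s\<close> and its difference quotient\<close>

text \<open>The smooth extension of \<open>(exp s - 1) / s\<close> across \<open>s = 0\<close>.\<close>

definition exp_mean :: "real \<Rightarrow> real" where
  "exp_mean s = integral (cbox 0 1) (\<lambda>u. exp (u * s))"

lemma mult_integral_exp:
  fixes c d :: real
  shows "integral (cbox 0 1) (\<lambda>r. c * exp (d + r * c)) = exp (d + c) - exp d"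
proof -
  have "((\<lambda>r. c * exp (d + r * c)) has_integral exp (d + 1 * c) - exp (d + 0 * c)) {0..1}"
    by (rule fundamental_theorem_of_calculus)
      (auto intro!: derivative_eq_intros simp flip: has_real_derivative_iff_has_vector_derivative)
  then show ?thesis by (simp add: integral_unique del: integral_mult_right)
qed

lemma mult_exp_mean: "s * exp_mean s = exp s - 1"
  using mult_integral_exp[of s 0] by (simp add: exp_mean_def)

lemma exp_mean_eq: "s \<noteq> 0 \<Longrightarrow> exp_mean s = (exp s - 1) / s"
  using mult_exp_mean[of s] by (simp add: field_simps)

lemma exp_mean_0 [simp]: "exp_mean 0 = 1"
  by (simp add: exp_mean_def)

lemma exp_mult_exp_mean_minus: "exp s * exp_mean (- s) = exp_mean s"
  by (cases "s = 0") (auto simp: exp_mean_eq exp_minus field_simps)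

lemma smooth_exp_mean_inner:
  fixes a :: "'a::euclidean_space"
  shows "smooth (\<lambda>x. c * exp_mean (a \<bullet> x))"
proof -
  have "smooth (\<lambda>x. integral (cbox 0 1) (\<lambda>u::real. c * exp ((u *\<^sub>R a) \<bullet> x)))"
    by (intro smooth_integral_exp continuous_intros)
  then show ?thesis by (simp add: exp_mean_def)
qed

lemma smooth_exp_inner:
  fixes a :: "'a::euclidean_space"
  shows "smooth (\<lambda>x. exp (a \<bullet> x))"
  using smooth_integral_exp[of "0::real" 1 "\<lambda>_. 1" "\<lambda>_. a"] by simp

text \<open>The smooth extension of the difference quotient \<open>(exp_mean (s + t) - exp_mean s) / t\<close> across
  \<open>t = 0\<close>; the integration variable is \<open>y = (u, r)\<close>.\<close>

definition exp_mean_quot :: "real \<times> real \<Rightarrow> real" where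
  "exp_mean_quot x =
     integral (cbox (0, 0) (1, 1)) (\<lambda>y. fst y * exp ((fst y, fst y * snd y) \<bullet> x))"

lemma smooth_exp_mean_quot: "smooth (\<lambda>x. c * exp_mean_quot x)"
proof -
  have "smooth (\<lambda>x. integral (cbox (0, 0) (1, 1))
      (\<lambda>y. (c * fst y) * exp ((fst y, fst y * snd y) \<bullet> x)))"
    by (intro smooth_integral_exp continuous_intros)
  then show ?thesis by (simp add: exp_mean_quot_def mult.assoc)
qed

lemma exp_mean_quot_eq:
  assumes "t \<noteq> 0"
  shows "exp_mean_quot (s, t) = (exp_mean (s + t) - exp_mean s) / t"
proof -
  have "exp_mean_quot (s, t) =
      integral (cbox 0 1) (\<lambda>u. integral (cbox 0 1) (\<lambda>r. u * exp (u * s + u * r * t)))"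
    unfolding exp_mean_quot_def
    by (subst integral_prod_continuous)
      (auto intro!: continuous_intros simp: inner_prod_def case_prod_beta)
  also have "\<dots> = integral (cbox 0 1) (\<lambda>u. (exp (u * (s + t)) - exp (u * s)) / t)"
  proof (rule integral_cong)
    fix u :: real
    have "t * integral (cbox 0 1) (\<lambda>r. u * exp (u * s + u * r * t)) =
        integral (cbox 0 1) (\<lambda>r. (u * t) * exp (u * s + r * (u * t)))"
      by (simp flip: integral_mult_right add: mult_ac)
    also have "\<dots> = exp (u * (s + t)) - exp (u * s)"
      by (simp only: mult_integral_exp distrib_left)
    finally show "integral (cbox 0 1) (\<lambda>r. u * exp (u * s + u * r * t)) =
        (exp (u * (s + t)) - exp (u * s)) / t"
      using assms by (simp add: field_simps)
  qed
  also have "\<dots> = (exp_mean (s + t) - exp_mean s) / t"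
    unfolding exp_mean_def integral_divide
    by (subst integral_diff) (auto intro!: integrable_continuous_real continuous_intros)
  finally show ?thesis .
qed

section \<open>The functions of the theorem\<close>

lemma k_tilde_eq: "k_tilde s = - exp_mean s"
proof -
  have "k = (\<lambda>s. - exp_mean (- s))"
    unfolding k_def
  proof (rule smooth_ext_eqI)
    show "negligible (- {s::real. s \<noteq> 0})"
      by (simp add: Compl_eq)
    show "smooth (\<lambda>s. - exp_mean (- s))"
      using smooth_exp_mean_inner[of "-1" "-1::real"] by simp
  qed (auto simp: exp_mean_eq field_simps)
  then have "k s = - exp_mean (- s)"
    by (rule fun_cong)
  then show ?thesis
    by (simp add: k_tilde_def exp_mult_exp_mean_minus)
qed

lemma diff_quot_k_tilde: "diff_quot k_tilde s t = - exp_mean_quot (s, t)"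
proof -
  have "smooth_ext {(s, t). t \<noteq> 0} (\<lambda>(s, t). (k_tilde (s + t) - k_tilde s) / t) =
      (\<lambda>x. - exp_mean_quot x)"
  proof (rule smooth_ext_eqI)
    have "- {(s::real, t::real). t \<noteq> 0} = {(s, t). t = 0}" by auto
    then show "negligible (- {(s::real, t::real). t \<noteq> 0})"
      using negligible_snd_eq_0 by simp
    show "smooth (\<lambda>x. - exp_mean_quot x)"
      using smooth_exp_mean_quot[of "-1"] by simp
  qed (auto simp: exp_mean_quot_eq k_tilde_eq field_simps)
  then show ?thesis by (simp add: diff_quot_def)
qed

text \<open>The elementary identity off the singular lines: the right-hand side of the theorem, in terms of
  \<open>exp_mean\<close>, against the quotient defining \<open>H\<close> without its factor \<open>exp (- s - t)\<close>.\<close>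

lemma H_numerator_identity:
  fixes s t :: real
  assumes "s \<noteq> 0" "t \<noteq> 0" "s + t \<noteq> 0"
  shows "-2 * exp_mean_quot (s, t) + 3 / 2 * exp_mean s * exp_mean t =
    ((exp s - 1) * (3 * exp t + 1) * t - (exp s + 3) * s * (exp t - 1)) / (2 * s * t * (s + t))"
proof -
  have "-2 * (((a * b - 1) / w - (a - 1) / s) / t) + 3 / 2 * ((a - 1) / s) * ((b - 1) / t) =
      ((a - 1) * (3 * b + 1) * t - (a + 3) * s * (b - 1)) / (2 * s * t * w)"
    if "w = s + t" "w \<noteq> 0" for a b w :: real
  proof -
    have "-2 * (((a * b - 1) / w - (a - 1) / s) / t) + 3 / 2 * ((a - 1) / s) * ((b - 1) / t) =
      (-4 * (s * (a * b - 1) - w * (a - 1)) + 3 * (a - 1) * (b - 1) * w) / (2 * s * t * w)"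
      using assms that(2) by (simp add: divide_simps)
    also have "-4 * (s * (a * b - 1) - w * (a - 1)) + 3 * (a - 1) * (b - 1) * w =
      (a - 1) * (3 * b + 1) * t - (a + 3) * s * (b - 1)"
      unfolding that(1) by (simp add: algebra_simps)
    finally show ?thesis .
  qed
  from this[of "s + t" "exp s" "exp t"] assms show ?thesis
    by (simp add: exp_mean_quot_eq exp_mean_eq exp_add)
qed

lemma H_eq:
  "H s t = exp (- s - t) * (-2 * exp_mean_quot (s, t) + 3 / 2 * exp_mean s * exp_mean t)"
proof -
  let ?S = "{(s, t). s \<noteq> 0 \<and> t \<noteq> 0 \<and> s + t \<noteq> 0} :: (real \<times> real) set"
  \<comment> \<open>The inner products and the factor \<open>1\<close> put each factor in the form of the smoothness lemmas.\<close>
  let ?G = "\<lambda>x. exp ((-1, -1) \<bullet> x) *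
    (-2 * exp_mean_quot x + 3 / 2 * exp_mean ((1, 0) \<bullet> x) * (1 * exp_mean ((0, 1) \<bullet> x)))"
  have "smooth_ext ?S (\<lambda>(s, t). exp (- s - t) *
        ((exp s - 1) * (3 * exp t + 1) * t - (exp s + 3) * s * (exp t - 1)) /
        (2 * s * t * (s + t))) = ?G"
  proof (rule smooth_ext_eqI)
    have "- ?S = {(s, t). s = 0} \<union> {(s, t). t = 0} \<union> {(s, t). s + t = 0}" by auto
    then show "negligible (- ?S)"
      using negligible_fst_eq_0 negligible_snd_eq_0 negligible_add_eq_0
      by (simp only: negligible_Un)
    show "smooth ?G"
      by (intro smooth_mult smooth_add smooth_exp_inner smooth_exp_mean_inner smooth_exp_mean_quot)
    fix x assume "x \<in> ?S"
    then obtain s t where x: "x = (s, t)" and st: "s \<noteq> 0" "t \<noteq> 0" "s + t \<noteq> 0" by auto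
    show "?G x = (case x of (s, t) \<Rightarrow> exp (- s - t) *
        ((exp s - 1) * (3 * exp t + 1) * t - (exp s + 3) * s * (exp t - 1)) /
        (2 * s * t * (s + t)))"
      using H_numerator_identity[OF st] by (simp add: x inner_prod_def)
  qed
  then show ?thesis by (simp add: H_def inner_prod_def)
qed

theorem theorem3p1:
  fixes s t :: real
  shows "H_tilde s t = 2 * diff_quot k_tilde s t + 3 / 2 * k_tilde s * k_tilde t"
proof -
  have "exp (s + t) * exp (- s - t) = 1"
    by (simp flip: exp_add)
  then show ?thesis
    by (simp add: H_tilde_def H_eq diff_quot_k_tilde k_tilde_eq flip: mult.assoc)
qed

end
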